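(* Let $\mathbb{K}$ be a field, $n\geq 2$ and $k\geq 1$ natural numbers, and $p=k(n-1)+1$. Let $\mathfrak{U}_n^p$ be the functor from Leibniz $n$-algebras over $\mathbb{K}$ to Leibniz $p$-algebras over $\mathbb{K}$ that sends a Leibniz $n$-algebra $\mathcal{L}$ to the same vector space $\mathcal{L}$ with the $p$-ary bracket \[ [l_1,\dots,l_p]=[l_1,\dots,l_{n-1},[l_n,\dots,l_{2n-2},[\dots,[l_{p-n+1},\dots,l_p]\dots]]] \] ($k$ nested $n$-ary brackets) and is the identity on underlying linear maps of homomorphisms. Then $\mathfrak{U}_n^p$ is an exact functor, and it preserves and reflects perfect objects; that is, a Leibniz $n$-algebra $\mathcal{L}$ is perfect if and only if the Leibniz $p$-algebra $\mathfrak{U}_n^p(\mathcal{L})$ is perfect.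
   Context: A Leibniz $n$-algebra over a field $\mathbb{K}$ is a vector space $\mathcal{L}$ with an $n$-linear operation $[-,\dots,-]:\mathcal{L}^{\otimes n}\to\mathcal{L}$ satisfying, for all elements, \[ [[x_1,\dots,x_n],y_2,\dots,y_n]=\sum_{i=1}^n[x_1,\dots,x_{i-1},[x_i,y_2,\dots,y_n],x_{i+1},\dots,x_n]. \] Homomorphisms are linear maps preserving the $n$-ary bracket. An $n$-sided ideal is a subalgebra $\mathcal{L}'$ with $[l_1,\dots,l_n]\in\mathcal{L}'$ whenever some $l_i\in\mathcal{L}'$. For a Leibniz $n$-algebra $\mathcal{L}$, $[\mathcal{L}^n]$ denotes the $n$-sided ideal spanned by all brackets $[l_1,\dots,l_n]$, $l_i\in\mathcal{L}$. $\mathcal{L}$ is perfect if $\mathcal{L}=[\mathcal{L}^n]$. It is known that the $p$-ary bracket in the definition of $\mathfrak{U}_n^p$ does make $\mathcal{L}$ a Leibniz $p$-algebra. Exactness means that short exact sequences $0\to M\to\mathcal{K}\to\mathcal{L}\to 0$ of Leibniz $n$-algebras (homomorphisms forming a short exact sequence of vector spaces) are sent to short exact sequences of Leibniz $p$-algebras. *)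

theory Defs
  imports Complex_Main
begin

text \<open>
  The underlying vector space of an algebra is the whole type \<open>'a\<close> with scalar multiplication
  \<open>smul\<close>. An \<open>n\<close>-ary bracket is a function on lists, of which only the values on lists of
  length \<open>n\<close> matter; the arity is an argument of the predicates below.
\<close>

record ('k, 'a) nary_algebra =
  smul :: "'k \<Rightarrow> 'a \<Rightarrow> 'a"
  bracket :: "'a list \<Rightarrow> 'a"

definition multilinear :: "nat \<Rightarrow> ('k::field, 'a::ab_group_add) nary_algebra \<Rightarrow> bool" where
  "multilinear n L \<longleftrightarrow>
     (\<forall>xs i. length xs = n \<and> i < n \<longrightarrow>
        Vector_Spaces.linear (smul L) (smul L) (\<lambda>x. bracket L (xs[i := x])))"

definition leibniz_algebra :: "nat \<Rightarrow> ('k::field, 'a::ab_group_add) nary_algebra \<Rightarrow> bool" where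
  "leibniz_algebra n L \<longleftrightarrow>
     vector_space (smul L) \<and>
     multilinear n L \<and>
     (\<forall>xs ys. length xs = n \<and> length ys = n - 1 \<longrightarrow>
        bracket L (bracket L xs # ys) =
          (\<Sum>i<n. bracket L (xs[i := bracket L (xs ! i # ys)])))"

definition leibniz_hom ::
  "nat \<Rightarrow> ('k::field, 'a::ab_group_add) nary_algebra \<Rightarrow> ('k, 'b::ab_group_add) nary_algebra
     \<Rightarrow> ('a \<Rightarrow> 'b) \<Rightarrow> bool" where
  "leibniz_hom n K L f \<longleftrightarrow>
     leibniz_algebra n K \<and> leibniz_algebra n L \<and>
     Vector_Spaces.linear (smul K) (smul L) f \<and>
     (\<forall>xs. length xs = n \<longrightarrow> f (bracket K xs) = bracket L (map f xs))"

definition short_exact ::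
  "nat \<Rightarrow> ('k::field, 'a::ab_group_add) nary_algebra \<Rightarrow> ('a \<Rightarrow> 'b)
     \<Rightarrow> ('k, 'b::ab_group_add) nary_algebra \<Rightarrow> ('b \<Rightarrow> 'c)
     \<Rightarrow> ('k, 'c::ab_group_add) nary_algebra \<Rightarrow> bool" where
  "short_exact n M f K g L \<longleftrightarrow>
     leibniz_hom n M K f \<and> leibniz_hom n K L g \<and>
     inj f \<and> range f = {y. g y = 0} \<and> surj g"

definition n_sided_ideal ::
  "nat \<Rightarrow> ('k::field, 'a::ab_group_add) nary_algebra \<Rightarrow> 'a set \<Rightarrow> bool" where
  "n_sided_ideal n L I \<longleftrightarrow>
     module.subspace (smul L) I \<and>
     (\<forall>xs. length xs = n \<and> set xs \<subseteq> I \<longrightarrow> bracket L xs \<in> I) \<and>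
     (\<forall>xs. length xs = n \<and> set xs \<inter> I \<noteq> {} \<longrightarrow> bracket L xs \<in> I)"

definition derived :: "nat \<Rightarrow> ('k::field, 'a::ab_group_add) nary_algebra \<Rightarrow> 'a set" where
  "derived n L = module.span (smul L) (bracket L ` {xs. length xs = n})"

lemma n_sided_ideal_derived:
  assumes "leibniz_algebra n L"
  shows "n_sided_ideal n L (derived n L)"
proof -
  interpret vector_space "smul L"
    using assms by (simp add: leibniz_algebra_def)
  show ?thesis
    by (auto simp: n_sided_ideal_def derived_def intro: span_base)
qed

definition perfect :: "nat \<Rightarrow> ('k::field, 'a::ab_group_add) nary_algebra \<Rightarrow> bool" where
  "perfect n L \<longleftrightarrow> derived n L = UNIV"

text \<open>
  \<open>nested n b k\<close> is meant for lists of length \<open>k * (n - 1) + 1\<close>. The case \<open>k = 0\<close> only starts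
  the recursion.
\<close>

fun nested :: "nat \<Rightarrow> ('a list \<Rightarrow> 'a) \<Rightarrow> nat \<Rightarrow> 'a list \<Rightarrow> 'a" where
  "nested n b 0 ls = hd ls"
| "nested n b (Suc k) ls = b (take (n - 1) ls @ [nested n b k (drop (n - 1) ls)])"

lemma nested_one:
  assumes "n \<ge> 1" and "length ls = n"
  shows "nested n b 1 ls = b ls"
proof -
  have "length (drop (n - 1) ls) = 1"
    using assms by simp
  then obtain x where x: "drop (n - 1) ls = [x]"
    by (metis One_nat_def length_0_conv length_Suc_conv)
  then have "ls = take (n - 1) ls @ [x]"
    by (metis append_take_drop_id)
  with x show ?thesis
    by simp
qed

definition U_obj ::
  "nat \<Rightarrow> nat \<Rightarrow> ('k::field, 'a::ab_group_add) nary_algebra \<Rightarrow> ('k, 'a) nary_algebra" where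
  "U_obj n k L = L\<lparr>bracket := nested n (bracket L) k\<rparr>"

definition U_map :: "('a \<Rightarrow> 'b) \<Rightarrow> 'a \<Rightarrow> 'b" where
  "U_map f = f"

end

theory Submission
  imports Defs
begin

text \<open>
  For \<open>k \<ge> 1\<close> the map \<open>x \<mapsto> [x, y\<^sub>2, \<dots>, y\<^sub>p]\<close> is \<open>x \<mapsto> [x, y\<^sub>2, \<dots>, y\<^bsub>n-1\<^esub>, z]\<close> with
  \<open>z = [y\<^sub>n, \<dots>, y\<^sub>p]\<close> the inner nested bracket. So it is a derivation of the \<open>n\<close>-ary bracket,
  hence of any iterate of it, which is the Leibniz identity for the \<open>p\<close>-ary bracket. Every
  \<open>p\<close>-ary bracket is an \<open>n\<close>-ary one; conversely, if \<open>\<L>\<close> is perfect then the innermost arguments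
  can repeatedly be replaced by sums of brackets, so the nested brackets span.
\<close>

lemma U_obj_simps [simp]:
  "smul (U_obj n k L) = smul L"
  "bracket (U_obj n k L) = nested n (bracket L) k"
  by (simp_all add: U_obj_def)

lemma length_nested_step:
  fixes n :: nat
  assumes "n \<ge> 1" and "length xs = Suc k * (n - 1) + 1"
  shows "length (take (n - 1) xs) = n - 1" and "length (drop (n - 1) xs) = k * (n - 1) + 1"
  using assms by auto

lemma sum_lessThan_add:
  fixes f :: "nat \<Rightarrow> 'a::comm_monoid_add"
  shows "(\<Sum>i<m + n. f i) = (\<Sum>i<m. f i) + (\<Sum>i<n. f (m + i))"
  by (induction n) (simp_all add: add.assoc)

text \<open>Nesting happens only in the last slot, so linearity there is put in the form of an
  appended argument.\<close>

lemma linear_bracket_last: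
  assumes "multilinear n L" and "n \<ge> 1" and "length xs = n - 1"
  shows "Vector_Spaces.linear (smul L) (smul L) (\<lambda>x. bracket L (xs @ [x]))"
proof -
  \<comment> \<open>The \<open>0\<close> is only a placeholder: the update at position
    \<open>n - 1\<close> overwrites it.\<close>
  have "length (xs @ [0]) = n \<and> n - 1 < n"
    using assms by simp
  then have "Vector_Spaces.linear (smul L) (smul L) (\<lambda>x. bracket L ((xs @ [0])[n - 1 := x]))"
    using assms(1) unfolding multilinear_def by blast
  then show ?thesis
    by (simp add: list_update_append assms(3))
qed

text \<open>Induction on \<open>k\<close>. Either \<open>i\<close> is one of the first
  \<open>n - 1\<close> positions, and the inner nested bracket is a constant argument of the outer
  bracket, or \<open>i\<close> lies in the inner block, and the map is a composite of two linear
  maps.\<close>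

lemma linear_nested:
  assumes "vector_space (smul L)" and "multilinear n L" and "n \<ge> 1"
    and "length xs = k * (n - 1) + 1" and "i < length xs"
  shows "Vector_Spaces.linear (smul L) (smul L) (\<lambda>x. nested n (bracket L) k (xs[i := x]))"
  using assms(4,5)
proof (induction k arbitrary: xs i)
  case 0
  then obtain a where "xs = [a]" "i = 0"
    by (auto simp: length_Suc_conv)
  then show ?case
    using vector_space.linear_ident[OF assms(1)] by simp
next
  case (Suc k)
  note len = length_nested_step[OF assms(3) Suc.prems(1)]
  show ?case
  proof (cases "i < n - 1")
    case True
    let ?ys = "take (n - 1) xs @ [nested n (bracket L) k (drop (n - 1) xs)]"
    have "length ?ys = n \<and> i < n"
      using len True assms(3) by simp
    then have "Vector_Spaces.linear (smul L) (smul L) (\<lambda>x. bracket L (?ys[i := x]))"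
      using assms(2) unfolding multilinear_def by blast
    moreover have "nested n (bracket L) (Suc k) (xs[i := x]) = bracket L (?ys[i := x])" for x
      using True len by (simp add: take_update_swap list_update_append)
    ultimately show ?thesis
      by simp
  next
    case False
    let ?j = "i - (n - 1)"
    have "?j < length (drop (n - 1) xs)"
      using False Suc.prems by simp
    then have "Vector_Spaces.linear (smul L) (smul L)
        (\<lambda>x. nested n (bracket L) k ((drop (n - 1) xs)[?j := x]))"
      using Suc.IH len(2) by blast
    from Vector_Spaces.linear_compose[OF this linear_bracket_last[OF assms(2,3) len(1)]]
    show ?thesis
      using False by (simp add: o_def drop_update_swap)
  qed
qed

text \<open>Induction on \<open>k\<close>: the derivation rule for the outer bracket leaves one term
  with \<open>D\<close> on the inner nested bracket. The induction hypothesis expands that term, and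
  linearity in the last slot pulls the sum out.\<close>

lemma derivation_nested:
  assumes "multilinear n L" and "n \<ge> 1"
    and D: "\<And>xs. length xs = n \<Longrightarrow> D (bracket L xs) = (\<Sum>i<n. bracket L (xs[i := D (xs ! i)]))"
    and "length xs = k * (n - 1) + 1"
  shows "D (nested n (bracket L) k xs) =
    (\<Sum>i<k * (n - 1) + 1. nested n (bracket L) k (xs[i := D (xs ! i)]))"
  using assms(4)
proof (induction k arbitrary: xs)
  case 0
  then show ?case
    by (auto simp: length_Suc_conv)
next
  case (Suc k)
  define t d where "t = take (n - 1) xs" and "d = drop (n - 1) xs"
  define N where "N = nested n (bracket L)"
  have t: "length t = n - 1" and d: "length d = k * (n - 1) + 1"
    using length_nested_step[OF assms(2) Suc.prems] by (simp_all add: t_def d_def)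
  have xs: "xs = t @ d"
    by (simp add: t_def d_def)
  interpret last: Vector_Spaces.linear "smul L" "smul L" "\<lambda>x. bracket L (t @ [x])"
    using linear_bracket_last[OF assms(1,2) t] .
  have "D (N (Suc k) xs) = D (bracket L (t @ [N k d]))"
    by (simp add: N_def t_def d_def)
  \<comment> \<open>Writing \<open>n\<close> as \<open>Suc (n - 1)\<close> lets the summand for the
    last slot split off.\<close>
  also have "\<dots> = (\<Sum>i<Suc (n - 1). bracket L ((t @ [N k d])[i := D ((t @ [N k d]) ! i)]))"
    using D[of "t @ [N k d]"] t assms(2) by simp
  also have "\<dots> = (\<Sum>i<n - 1. bracket L (t[i := D (t ! i)] @ [N k d])) +
      bracket L (t @ [D (N k d)])"
    by (simp add: t list_update_append nth_append)
  also have "(\<Sum>i<n - 1. bracket L (t[i := D (t ! i)] @ [N k d])) =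
      (\<Sum>i<n - 1. N (Suc k) (xs[i := D (xs ! i)]))"
    by (intro sum.cong) (auto simp: N_def xs t list_update_append nth_append)
  also have "bracket L (t @ [D (N k d)]) =
      (\<Sum>j<k * (n - 1) + 1. bracket L (t @ [N k (d[j := D (d ! j)])]))"
    using Suc.IH[OF d] by (simp only: N_def last.sum)
  \<comment> \<open>Position \<open>j\<close> of the inner block is position
    \<open>n - 1 + j\<close> of \<open>xs\<close>, so the two sums join into one.\<close>
  also have "\<dots> = (\<Sum>j<k * (n - 1) + 1. N (Suc k) (xs[n - 1 + j := D (xs ! (n - 1 + j))]))"
    by (intro sum.cong) (auto simp: N_def xs t list_update_append nth_append)
  also have "(\<Sum>i<n - 1. N (Suc k) (xs[i := D (xs ! i)])) + \<dots> =
      (\<Sum>i<n - 1 + (k * (n - 1) + 1). N (Suc k) (xs[i := D (xs ! i)]))"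
    by (simp only: sum_lessThan_add)
  finally show ?case
    by (simp add: N_def add.assoc)
qed

lemma nested_Suc_bracket:
  assumes "n \<ge> 1" and "length xs = Suc k * (n - 1) + 1"
  obtains ys where "length ys = n" and "nested n b (Suc k) xs = b ys"
  using length_nested_step[OF assms] assms(1)
  by (intro that[of "take (n - 1) xs @ [nested n b k (drop (n - 1) xs)]"]) auto

lemma leibniz_algebra_U_obj:
  assumes "leibniz_algebra n L" and "n \<ge> 2" and "k \<ge> 1"
  shows "leibniz_algebra (k * (n - 1) + 1) (U_obj n k L)"
proof -
  let ?p = "k * (n - 1) + 1"
  define N where "N = nested n (bracket L)"
  have vs: "vector_space (smul L)" and ml: "multilinear n L"
    and leib: "\<And>xs ys. length xs = n \<Longrightarrow> length ys = n - 1 \<Longrightarrow>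
        bracket L (bracket L xs # ys) = (\<Sum>i<n. bracket L (xs[i := bracket L (xs ! i # ys)]))"
    using assms(1) by (auto simp: leibniz_algebra_def)
  have n: "n \<ge> 1"
    using assms(2) by simp
  obtain j where k: "k = Suc j"
    using assms(3) by (cases k) auto
  obtain m where m: "n = Suc (Suc m)"
    using assms(2) by (metis add_2_eq_Suc le_Suc_ex)
  have "N k (N k xs # ys) = (\<Sum>i<?p. N k (xs[i := N k (xs ! i # ys)]))"
    if "length xs = ?p" "length ys = ?p - 1" for xs ys
  proof -
    \<comment> \<open>The argument \<open>x\<close> in front fills one of the first
      \<open>n - 1\<close> outer slots, so only \<open>m = n - 2\<close> entries of
      \<open>ys\<close> stay outside the inner bracket. Hence \<open>zs\<close> does not depend on
      \<open>x\<close>.\<close>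
    define zs where "zs = take m ys @ [N j (drop m ys)]"
    have "length zs = n - 1"
      using that(2) by (simp add: zs_def k m)
    moreover have "N k (x # ys) = bracket L (x # zs)" for x
      by (simp add: N_def zs_def k m)
    ultimately show ?thesis
      using derivation_nested[OF ml n, of "\<lambda>x. bracket L (x # zs)"] leib that(1)
      by (simp add: N_def)
  qed
  moreover have "multilinear ?p (U_obj n k L)"
    using linear_nested[OF vs ml n] by (simp add: multilinear_def)
  ultimately show ?thesis
    using vs by (simp add: leibniz_algebra_def N_def)
qed

lemma hom_nested:
  assumes "n \<ge> 1" and "\<And>xs. length xs = n \<Longrightarrow> f (b xs) = c (map f xs)"
    and "length xs = k * (n - 1) + 1"
  shows "f (nested n b k xs) = nested n c k (map f xs)"
  using assms(3)
proof (induction k arbitrary: xs)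
  case 0
  then show ?case
    by (auto simp: length_Suc_conv)
next
  case (Suc k)
  note len = length_nested_step[OF assms(1) Suc.prems]
  show ?case
    using assms(1,2) len Suc.IH[OF len(2)] by (simp add: take_map drop_map)
qed

lemma leibniz_hom_U_map:
  assumes "leibniz_hom n K L f" and "n \<ge> 2" and "k \<ge> 1"
  shows "leibniz_hom (k * (n - 1) + 1) (U_obj n k K) (U_obj n k L) (U_map f)"
proof -
  have "leibniz_algebra n K" "leibniz_algebra n L"
    using assms(1) by (simp_all add: leibniz_hom_def)
  then have "leibniz_algebra (k * (n - 1) + 1) (U_obj n k K)"
    "leibniz_algebra (k * (n - 1) + 1) (U_obj n k L)"
    using leibniz_algebra_U_obj assms(2,3) by blast+
  then show ?thesis
    using assms hom_nested[of n f "bracket K" "bracket L"]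
    by (simp add: leibniz_hom_def U_map_def)
qed

text \<open>Injectivity, surjectivity and the kernel condition concern only the underlying maps,
  which do not change; only the homomorphism property has to be transported.\<close>

lemma short_exact_U:
  assumes "short_exact n M f K g L" and "n \<ge> 2" and "k \<ge> 1"
  shows "short_exact (k * (n - 1) + 1) (U_obj n k M) (U_map f) (U_obj n k K) (U_map g) (U_obj n k L)"
  using assms leibniz_hom_U_map[of n M K f k] leibniz_hom_U_map[of n K L g k]
  by (simp add: short_exact_def U_map_def)

text \<open>This gives reflection of perfectness: for \<open>k \<ge> 1\<close> each generator on the
  left is, by its outermost bracket, a generator on the right.\<close>

lemma derived_U_obj_subset:
  assumes "vector_space (smul L)" and "n \<ge> 1" and "k \<ge> 1"
  shows "derived (k * (n - 1) + 1) (U_obj n k L) \<subseteq> derived n L"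
proof -
  interpret vector_space "smul L"
    by fact
  obtain j where k: "k = Suc j"
    using assms(3) by (cases k) auto
  have "nested n (bracket L) k xs \<in> bracket L ` {xs. length xs = n}"
    if "length xs = k * (n - 1) + 1" for xs
    using nested_Suc_bracket[OF assms(2), of xs j "bracket L"] that by (auto simp: k)
  then show ?thesis
    unfolding derived_def by (auto simp del: nested.simps intro!: span_mono)
qed

lemma perfect_U_obj:
  assumes "vector_space (smul L)" and "multilinear n L" and "n \<ge> 1" and "perfect n L"
  shows "perfect (k * (n - 1) + 1) (U_obj n k L)"
proof -
  interpret vector_space "smul L"
    by fact
  show ?thesis
  proof (induction k)
    case 0
    \<comment> \<open>For \<open>k = 0\<close> the bracket is the unary identity, whose values are
      all elements.\<close>
    have "x \<in> span (hd ` {xs. length xs = 1})" for x :: 'b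
      by (intro span_base image_eqI[of _ _ "[x]"]) auto
    then show ?case
      by (auto simp: perfect_def derived_def)
  next
    case (Suc k)
    let ?V = "\<lambda>k. nested n (bracket L) k ` {xs. length xs = k * (n - 1) + 1}"
    have IH: "span (?V k) = UNIV"
      using Suc by (simp add: perfect_def derived_def)
    \<comment> \<open>By the induction hypothesis \<open>z\<close> is a combination of
      \<open>k\<close>-fold nested brackets. Linearity in the last slot turns the bracket into a
      combination of \<open>Suc k\<close>-fold ones.\<close>
    have step: "bracket L (t @ [z]) \<in> span (?V (Suc k))" if t: "length t = n - 1" for t z
    proof -
      interpret last: Vector_Spaces.linear "smul L" "smul L" "\<lambda>x. bracket L (t @ [x])"
        using linear_bracket_last[OF assms(2,3) t] .
      have "bracket L (t @ [nested n (bracket L) k xs]) \<in> ?V (Suc k)"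
        if "length xs = k * (n - 1) + 1" for xs
        using that t by (intro image_eqI[of _ _ "t @ xs"]) auto
      then have "(\<lambda>x. bracket L (t @ [x])) ` span (?V k) \<subseteq> span (?V (Suc k))"
        unfolding last.span_image[symmetric] by (intro span_mono) auto
      then show ?thesis
        using IH by blast
    qed
    have "bracket L xs \<in> span (?V (Suc k))" if "length xs = n" for xs
      using step[of "butlast xs" "last xs"] that assms(3)
      by (metis append_butlast_last_id length_butlast list.size(3) not_one_le_zero)
    \<comment> \<open>Perfectness of \<open>L\<close> makes the left-hand span the whole
      space.\<close>
    then have "span (bracket L ` {xs. length xs = n}) \<subseteq> span (?V (Suc k))"
      by (intro span_minimal) auto
    then show ?case
      using assms(4) by (auto simp: perfect_def derived_def simp del: nested.simps)
  qed
qed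

theorem theorem3p5:
  fixes n k p :: nat
  assumes "n \<ge> 2" and "k \<ge> 1" and "p = k * (n - 1) + 1"
  shows
    "(\<forall>L :: ('k::field, 'a::ab_group_add) nary_algebra.
        leibniz_algebra n L \<longrightarrow> leibniz_algebra p (U_obj n k L))
   \<and> (\<forall>(K :: ('k, 'a) nary_algebra) (L :: ('k, 'b::ab_group_add) nary_algebra) f.
        leibniz_hom n K L f \<longrightarrow> leibniz_hom p (U_obj n k K) (U_obj n k L) (U_map f))
   \<and> U_map (id :: 'a \<Rightarrow> 'a) = id
   \<and> (\<forall>(M :: ('k, 'a) nary_algebra) (K :: ('k, 'b) nary_algebra)
         (L :: ('k, 'c::ab_group_add) nary_algebra) f g.
        leibniz_hom n M K f \<and> leibniz_hom n K L g \<longrightarrow>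
          U_map (g \<circ> f) = U_map g \<circ> U_map f)
   \<and> (\<forall>(M :: ('k, 'a) nary_algebra) (K :: ('k, 'b) nary_algebra)
         (L :: ('k, 'c) nary_algebra) f g.
        short_exact n M f K g L \<longrightarrow>
          short_exact p (U_obj n k M) (U_map f) (U_obj n k K) (U_map g) (U_obj n k L))
   \<and> (\<forall>L :: ('k, 'a) nary_algebra.
        leibniz_algebra n L \<longrightarrow> (perfect n L \<longleftrightarrow> perfect p (U_obj n k L)))"
proof (intro conjI allI impI)
  fix L :: "('k, 'a) nary_algebra"
  assume L: "leibniz_algebra n L"
  then have "vector_space (smul L)" "multilinear n L"
    by (simp_all add: leibniz_algebra_def)
  moreover have "n \<ge> 1"
    using assms by simp
  ultimately show "perfect n L \<longleftrightarrow> perfect p (U_obj n k L)"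
    using perfect_U_obj derived_U_obj_subset assms unfolding perfect_def by blast
qed (use assms leibniz_algebra_U_obj leibniz_hom_U_map short_exact_U in \<open>auto simp: U_map_def\<close>)

end
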